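(* Let $G$ be a layered graph with $\ell\geq 1$ layers and width $w\geq 1$, and let $\hat c_e\ge0$ and $d_e\ge0$ be edge weights. For the bicriteria shortest path problem $\min_{P\in\mathcal{P}}(\hat c(P),\ d(P))^t$ one has $|\mathcal{E}_{\min}|\le(2w)^{\lceil\log_2(\ell+1)\rceil}$.
   Context: A layered graph consists of a source node $s$, a destination node $t$, and $\ell$ layers, each consisting of $w$ nodes. Node $s$ is fully connected (by edges directed forward) to the first layer, the nodes of the $i$-th layer are fully connected to the nodes of the $(i+1)$-th layer, and the last layer is fully connected to node $t$. Let $\mathcal{P}$ be the set of all paths from $s$ to $t$ and $c(P)=\sum_{e\in P}c_e$. Let $F(P)=(\hat c(P),d(P))^t$ and $\mathcal{V}=\operatorname{conv}(\{F(P):P\in\mathcal{P}\})+\mathbb{R}^2_+$. A path $P$ is an efficient extreme solution if $F(P)$ is a vertex of $\mathcal{V}$. Two paths $P\neq P'$ are equivalent if $F(P)=F(P')$. $\mathcal{E}_{\min}$ is a maximal subset of the set of efficient extreme solutions containing no two equivalent solutions. *)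

theory Defs
  imports "HOL-Analysis.Analysis" "Graph_Theory.Weighted_Graph"
begin

(* L i is the i-th layer, with i ranging over {1..l}; the other values of L are irrelevant.
   Since digraph excludes parallel arcs, the condition on arcs_ends determines the arcs:
   there is exactly one for each listed pair, and there are no others. *)
locale layered_graph = digraph G for G :: "('a, 'b) pre_digraph" (structure) +
  fixes s t :: 'a
    and l w :: nat
    and L :: "nat \<Rightarrow> 'a set"
  assumes source_neq_dest: "s \<noteq> t"
    and source_notin_layers: "s \<notin> (\<Union>i\<in>{1..l}. L i)"
    and dest_notin_layers: "t \<notin> (\<Union>i\<in>{1..l}. L i)"
    and layers_disjoint: "disjoint_family_on L {1..l}"
    and layer_finite: "\<And>i. i \<in> {1..l} \<Longrightarrow> finite (L i)"
    and layer_card: "\<And>i. i \<in> {1..l} \<Longrightarrow> card (L i) = w"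
    and verts_eq: "verts G = {s, t} \<union> (\<Union>i\<in>{1..l}. L i)"
    and arcs_eq: "arcs_ends G =
          {s} \<times> L 1 \<union> (\<Union>i\<in>{1..<l}. L i \<times> L (Suc i)) \<union> L l \<times> {t}"

definition st_paths :: "('a, 'b) pre_digraph \<Rightarrow> 'a \<Rightarrow> 'a \<Rightarrow> 'b awalk set" where
  "st_paths G s t = {P. pre_digraph.apath G s P t}"

definition path_objective :: "('b \<Rightarrow> real) \<Rightarrow> ('b \<Rightarrow> real) \<Rightarrow> 'b awalk \<Rightarrow> real \<times> real" where
  "path_objective c d P = (wf_digraph.awalk_cost c P, wf_digraph.awalk_cost d P)"

definition upper_image :: "('x \<Rightarrow> real \<times> real) \<Rightarrow> 'x set \<Rightarrow> (real \<times> real) set" where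
  "upper_image F X = {y + z | y z. y \<in> convex hull (F ` X) \<and> z \<in> {0..} \<times> {0..}}"

(* The vertices of the polyhedron are its extreme points. *)
definition efficient_extreme :: "('x \<Rightarrow> real \<times> real) \<Rightarrow> 'x set \<Rightarrow> 'x set" where
  "efficient_extreme F X = {x \<in> X. F x extreme_point_of upper_image F X}"

definition pairwise_inequivalent :: "('x \<Rightarrow> real \<times> real) \<Rightarrow> 'x set \<Rightarrow> bool" where
  "pairwise_inequivalent F E \<longleftrightarrow> (\<forall>x\<in>E. \<forall>y\<in>E. x \<noteq> y \<longrightarrow> F x \<noteq> F y)"

(* Such a set E is not unique; maximality is with respect to inclusion. *)
definition is_E_min :: "('x \<Rightarrow> real \<times> real) \<Rightarrow> 'x set \<Rightarrow> 'x set \<Rightarrow> bool" where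
  "is_E_min F X E \<longleftrightarrow>
     E \<subseteq> efficient_extreme F X \<and> pairwise_inequivalent F E \<and>
     (\<forall>E'. E \<subseteq> E' \<and> E' \<subseteq> efficient_extreme F X \<and> pairwise_inequivalent F E' \<longrightarrow> E' = E)"

end

(*
  The vertices of the upper image of a finite planar set are among its unique minimizers for
  linear functionals with coefficient sum 1, which form a one-parameter family.  Along the
  parameter, the minimizer of either summand of a Minkowski sum moves monotonically, so the pairs
  of simultaneous minimizers form a chain in a product of two finite linear orders; hence
  Minkowski sums of sets with p and q such points have at most p + q of them.  Cutting all walks
  in their middle layer writes the set of cost vectors as a union over the at most w middle nodes
  of Minkowski sums of cost vectors of half-length walks, so the count grows by a factor of at most
  2 w whenever the number of arcs doubles.
*)
theory Submission
  imports Defs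
begin

section \<open>Unique minimizers of planar sets\<close>

text \<open>The functional with weights \<open>1 - t\<close> and \<open>t\<close>, written so that
  its slope in \<open>t\<close>, namely \<open>snd v - fst v\<close>, is visible.\<close>

definition scal :: "real \<Rightarrow> real \<times> real \<Rightarrow> real" where
  "scal t v = fst v + t * (snd v - fst v)"

definition unique_min :: "real \<Rightarrow> (real \<times> real) set \<Rightarrow> real \<times> real \<Rightarrow> bool" where
  "unique_min t S v \<longleftrightarrow> v \<in> S \<and> (\<forall>u\<in>S. u \<noteq> v \<longrightarrow> scal t v < scal t u)"

definition unique_mins :: "(real \<times> real) set \<Rightarrow> (real \<times> real) set" where
  "unique_mins S = {v. \<exists>t. unique_min t S v}"

lemma scal_add: "scal t (u + v) = scal t u + scal t v"
  by (simp add: scal_def algebra_simps)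

lemma unique_mins_subset: "unique_mins S \<subseteq> S"
  by (auto simp: unique_mins_def unique_min_def)

lemma unique_mins_UN_subset: "unique_mins (\<Union>x\<in>I. A x) \<subseteq> (\<Union>x\<in>I. unique_mins (A x))"
  by (fastforce simp: unique_mins_def unique_min_def)

lemma unique_min_unique: "unique_min t S a \<Longrightarrow> unique_min t S a' \<Longrightarrow> a = a'"
  unfolding unique_min_def by (metis less_asym)

text \<open>Exchange argument: the strict inequalities at \<open>t\<close> and \<open>t'\<close> are
  added, the terms free of the parameter cancel, and \<open>t' - t\<close> times the difference of
  slopes remains.\<close>

lemma unique_min_antimono:
  assumes "unique_min t S a" "unique_min t' S a'" "t \<le> t'"
  shows "a = a' \<or> snd a' - fst a' < snd a - fst a"
proof (cases "a = a'")
  case False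
  then have "t < t'"
    using assms unique_min_unique by (metis less_eq_real_def)
  have "scal t a < scal t a'" "scal t' a' < scal t' a"
    using assms False by (auto simp: unique_min_def)
  then have "0 < (t' - t) * ((snd a - fst a) - (snd a' - fst a'))"
    by (simp add: scal_def algebra_simps)
  with \<open>t < t'\<close> show ?thesis
    by (simp add: zero_less_mult_iff)
qed simp

text \<open>Varying one summand while the other stays fixed shows that each is optimal for the same
  \<open>t\<close>.\<close>

lemma unique_min_plus:
  assumes "unique_min t (A + B) v"
  obtains a b where "v = a + b" "unique_min t A a" "unique_min t B b"
proof -
  from assms obtain a b where ab: "v = a + b" "a \<in> A" "b \<in> B"
    by (auto simp: unique_min_def set_plus_def)
  have *: "scal t v < scal t (x + y)" if "x \<in> A" "y \<in> B" "x + y \<noteq> v" for x y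
    using assms that set_plus_intro[OF that(1,2)] by (auto simp: unique_min_def)
  have "unique_min t A a"
    unfolding unique_min_def using ab *[of _ b] by (auto simp: scal_add)
  moreover have "unique_min t B b"
    unfolding unique_min_def using ab *[of a] by (auto simp: scal_add)
  ultimately show thesis
    using ab that by blast
qed

lemma card_unique_mins_plus:
  assumes fin: "finite (unique_mins A)" "finite (unique_mins B)"
  shows "finite (unique_mins (A + B)) \<and>
    card (unique_mins (A + B)) \<le> card (unique_mins A) + card (unique_mins B)"
proof -
  \<comment> \<open>The chain of pairs selected by a common parameter; every unique minimizer of the
    sum comes from such a pair.\<close>
  define R where "R = {(a, b). \<exists>t. unique_min t A a \<and> unique_min t B b}"
  \<comment> \<open>Position of \<open>a\<close> in the order by slope, at least 1 for unique
    minimizers; it drops strictly whenever the minimizer changes as the parameter grows.\<close>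
  define rk :: "(real \<times> real) set \<Rightarrow> real \<times> real \<Rightarrow> nat"
    where "rk S a = card {x \<in> unique_mins S. snd x - fst x \<le> snd a - fst a}" for S a
  have rk_le: "rk S a \<le> card (unique_mins S)" if "finite (unique_mins S)" for S a
    unfolding rk_def using that by (intro card_mono) auto
  have rk_pos: "0 < rk S a" if "finite (unique_mins S)" "a \<in> unique_mins S" for S a
  proof -
    have "{x \<in> unique_mins S. snd x - fst x \<le> snd a - fst a} \<noteq> {}"
      using that by blast
    then show ?thesis
      unfolding rk_def card_gt_0_iff using that(1) by simp
  qed
  have rk_mono: "a = a' \<or> rk S a' < rk S a"
    if "finite (unique_mins S)" "unique_min t S a" "unique_min t' S a'" "t \<le> t'" for S t t' a a'
  proof (cases "a = a'")
    case False
    then have lt: "snd a' - fst a' < snd a - fst a"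
      using unique_min_antimono that by blast
    have "a \<in> unique_mins S"
      using that by (auto simp: unique_mins_def)
    with lt have "a \<in> {x \<in> unique_mins S. snd x - fst x \<le> snd a - fst a}
        - {x \<in> unique_mins S. snd x - fst x \<le> snd a' - fst a'}"
      by simp
    moreover have "{x \<in> unique_mins S. snd x - fst x \<le> snd a' - fst a'}
        \<subseteq> {x \<in> unique_mins S. snd x - fst x \<le> snd a - fst a}"
      using lt by auto
    ultimately have "{x \<in> unique_mins S. snd x - fst x \<le> snd a' - fst a'}
        \<subset> {x \<in> unique_mins S. snd x - fst x \<le> snd a - fst a}"
      by blast
    then show ?thesis
      unfolding rk_def using that(1) by (auto intro: psubset_card_mono)
  qed simp
  \<comment> \<open>Neither rank can rise with the parameter, so equal sums leave both ranks, and
    hence both minimizers, unchanged.\<close>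
  have R_le: "a = a' \<and> b = b'"
    if "unique_min t A a" "unique_min t B b" "unique_min t' A a'" "unique_min t' B b'" "t \<le> t'"
      "rk A a + rk B b = rk A a' + rk B b'" for t t' a b a' b'
    using rk_mono[OF fin(1) that(1,3,5)] rk_mono[OF fin(2) that(2,4,5)] that(6) by auto
  have inj: "inj_on (\<lambda>(a, b). rk A a + rk B b) R"
  proof (rule inj_onI, clarify)
    fix a b a' b'
    assume "(a, b) \<in> R" "(a', b') \<in> R" and eq: "rk A a + rk B b = rk A a' + rk B b'"
    then obtain t t' where t: "unique_min t A a" "unique_min t B b"
        "unique_min t' A a'" "unique_min t' B b'"
      by (auto simp: R_def)
    show "a = a' \<and> b = b'"
      using R_le[OF t _ eq] R_le[OF t(3,4,1,2) _ eq[symmetric]] by (cases "t \<le> t'") auto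
  qed
  have R_sub: "R \<subseteq> unique_mins A \<times> unique_mins B"
    by (auto simp: R_def unique_mins_def)
  then have "finite R"
    using fin finite_subset by blast
  \<comment> \<open>Positivity of the first rank excludes the sum 0; otherwise one value too many
    would be counted.\<close>
  have "(\<lambda>(a, b). rk A a + rk B b) ` R \<subseteq> {1..card (unique_mins A) + card (unique_mins B)}"
  proof clarify
    fix a b assume "(a, b) \<in> R"
    then have "0 < rk A a"
      using R_sub rk_pos fin by blast
    then show "rk A a + rk B b \<in> {1..card (unique_mins A) + card (unique_mins B)}"
      using rk_le[OF fin(1), of a] rk_le[OF fin(2), of b] by simp
  qed
  then have "card R \<le> card (unique_mins A) + card (unique_mins B)"
    using card_inj_on_le[OF inj, of "{1..card (unique_mins A) + card (unique_mins B)}"] by simp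
  moreover have sub: "unique_mins (A + B) \<subseteq> (\<lambda>(a, b). a + b) ` R"
  proof
    fix v assume "v \<in> unique_mins (A + B)"
    then obtain t where "unique_min t (A + B) v"
      by (auto simp: unique_mins_def)
    then obtain a b where "v = a + b" "unique_min t A a" "unique_min t B b"
      by (rule unique_min_plus)
    then show "v \<in> (\<lambda>(a, b). a + b) ` R"
      by (auto simp: R_def intro!: image_eqI[of _ _ "(a, b)"])
  qed
  moreover have "card (unique_mins (A + B)) \<le> card R"
    using surj_card_le[OF \<open>finite R\<close> sub] .
  moreover have "finite (unique_mins (A + B))"
    using finite_surj[OF \<open>finite R\<close> sub] .
  ultimately show ?thesis
    by linarith
qed

section \<open>Vertices of the upper image\<close>

lemma upper_image_eq: "upper_image F X = convex hull (F ` X) + {0..} \<times> {0..}"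
  unfolding upper_image_def set_plus_def by blast

lemma convex_hull_subset_upper_image: "convex hull (F ` X) \<subseteq> upper_image F X"
proof
  fix y assume "y \<in> convex hull (F ` X)"
  moreover have "0 \<in> {0::real..} \<times> {0::real..}"
    by (simp add: zero_prod_def)
  ultimately show "y \<in> upper_image F X"
    unfolding upper_image_eq by (metis add.right_neutral set_plus_intro)
qed

lemma convex_upper_image: "convex (upper_image F X)"
  unfolding upper_image_eq by (intro convex_set_plus convex_Times) auto

lemma closed_upper_image:
  assumes "finite (F ` X)"
  shows "closed (upper_image F X)"
proof -
  have "upper_image F X = (\<Union>y\<in>convex hull (F ` X). \<Union>z\<in>{0..} \<times> {0..}. {y + z})"
    unfolding upper_image_def by blast
  then show ?thesis
    using assms
    by (simp add: compact_closed_sums closed_Times finite_imp_compact_convex_hull)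
qed

text \<open>If \<open>p = y + z\<close> with \<open>y\<close> in the hull of the other values, then
  \<open>p\<close> is the midpoint of \<open>y\<close> and \<open>y + (z + z)\<close>, so
  extremality forces \<open>z = 0\<close>. But an extreme point of a convex hull is one of its
  generators.\<close>

lemma extreme_point_notin_upper_image_others:
  assumes "p extreme_point_of upper_image F X"
  shows "p \<notin> upper_image F {x \<in> X. F x \<noteq> p}"
proof
  assume "p \<in> upper_image F {x \<in> X. F x \<noteq> p}"
  then obtain y z where yz: "p = y + z" "y \<in> convex hull (F ` {x \<in> X. F x \<noteq> p})"
      "z \<in> {0..} \<times> {0..}"
    by (auto simp: upper_image_def)
  have y: "y \<in> convex hull (F ` X)"
    using yz(2) hull_mono[of "F ` {x \<in> X. F x \<noteq> p}" "F ` X" convex] by auto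
  have "z + z \<in> {0..} \<times> {0..}"
    using yz(3) by auto
  then have "y + (z + z) \<in> upper_image F X"
    unfolding upper_image_eq by (intro set_plus_intro y)
  moreover have "y \<in> upper_image F X"
    using y convex_hull_subset_upper_image by blast
  ultimately have "p \<notin> open_segment y (y + (z + z))"
    using assms by (auto simp: extreme_point_of_def)
  moreover have "p = (1 - 1 / 2) *\<^sub>R y + (1 / 2) *\<^sub>R (y + (z + z))"
    by (simp add: yz(1) prod_eq_iff field_simps)
  ultimately have "y = y + (z + z)"
    unfolding in_segment by (metis half_gt_zero_iff zero_less_one field_sum_of_halves
        less_add_same_cancel1)
  then have "z = 0"
    by (simp add: prod_eq_iff)
  then have p: "p \<in> convex hull (F ` {x \<in> X. F x \<noteq> p})"
    using yz by simp
  have "convex hull (F ` {x \<in> X. F x \<noteq> p}) \<subseteq> upper_image F X"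
    using hull_mono[of "F ` {x \<in> X. F x \<noteq> p}" "F ` X" convex] convex_hull_subset_upper_image
    by blast
  then have "p extreme_point_of convex hull (F ` {x \<in> X. F x \<noteq> p})"
    using p assms by (auto simp: extreme_point_of_def)
  then show False
    using extreme_point_of_convex_hull by blast
qed

text \<open>Strict separation of \<open>F x\<close> from the upper image of the solutions with other
  values gives a functional. The recession cone makes its weights nonnegative, and scaling their sum
  to 1 gives \<open>t\<close>.\<close>

lemma extreme_point_in_unique_mins:
  assumes fin: "finite (F ` X)" and x: "x \<in> X" and ext: "F x extreme_point_of upper_image F X"
  shows "F x \<in> unique_mins (F ` X)"
proof (cases "\<exists>x'\<in>X. F x' \<noteq> F x")
  \<comment> \<open>With a single value there is nothing to separate from, and any parameter
    works.\<close>
  case False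
  with x have "F ` X = {F x}"
    by blast
  then show ?thesis
    by (simp add: unique_mins_def unique_min_def)
next
  case True
  then obtain x' where x': "x' \<in> X" "F x' \<noteq> F x"
    by blast
  define Y where "Y = {x' \<in> X. F x' \<noteq> F x}"
  have "closed (upper_image F Y)"
    by (intro closed_upper_image finite_subset[OF _ fin]) (auto simp: Y_def)
  moreover have "F x \<notin> upper_image F Y"
    using extreme_point_notin_upper_image_others[OF ext] by (simp add: Y_def)
  ultimately obtain a b where ab: "a \<bullet> F x < b" "\<And>u. u \<in> upper_image F Y \<Longrightarrow> b < a \<bullet> u"
    using separating_hyperplane_closed_point[OF convex_upper_image] by metis
  have FY: "F y + z \<in> upper_image F Y" if "y \<in> Y" "z \<in> {0..} \<times> {0..}" for y z
    unfolding upper_image_eq using that hull_inc[of "F y" "F ` Y"] by (intro set_plus_intro) auto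
  define \<alpha> \<beta> where "\<alpha> = fst a" "\<beta> = snd a"
  have a: "a \<bullet> v = \<alpha> * fst v + \<beta> * snd v" for v
    by (simp add: inner_prod_def \<alpha>_\<beta>_def)
  have less: "a \<bullet> F x < a \<bullet> F y" if "y \<in> Y" for y
    using ab(1) ab(2)[OF FY[OF that, of "(0, 0)"]] by (simp add: a)
  have x'Y: "x' \<in> Y"
    using x' by (simp add: Y_def)
  have ray: "b < a \<bullet> F x' + r * (a \<bullet> z)" if "0 \<le> r" "z \<in> {0..} \<times> {0..}" for r z
  proof -
    have "r *\<^sub>R z \<in> {0..} \<times> {0..}"
      using that by auto
    from ab(2)[OF FY[OF x'Y this]] show ?thesis
      by (simp add: inner_add_right)
  qed
  have nonneg: "0 \<le> a \<bullet> z" if z: "z \<in> {0..} \<times> {0..}" for z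
  proof (rule ccontr)
    assume "\<not> 0 \<le> a \<bullet> z"
    moreover have "b < a \<bullet> F x'"
      using ray[of 0 z] z by simp
    ultimately show False
      \<comment> \<open>At this \<open>r\<close> the functional would equal \<open>b\<close> on the
        ray; \<open>r\<close> is nonnegative because numerator and denominator are both
        negative.\<close>
      using ray[of "(b - a \<bullet> F x') / (a \<bullet> z)" z] z
      by (simp add: divide_nonpos_neg)
  qed
  have "0 \<le> \<alpha>" "0 \<le> \<beta>"
    using nonneg[of "(1, 0)"] nonneg[of "(0, 1)"] by (auto simp: a)
  moreover have "\<alpha> \<noteq> 0 \<or> \<beta> \<noteq> 0"
    using less[OF x'Y] by (auto simp: a)
  ultimately have pos: "0 < \<alpha> + \<beta>"
    by linarith
  define t where "t = \<beta> / (\<alpha> + \<beta>)"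
  have scal: "(\<alpha> + \<beta>) * scal t v = a \<bullet> v" for v
    using pos by (simp add: scal_def a t_def field_simps)
  have "scal t (F x) < scal t (F y)" if "y \<in> X" "F y \<noteq> F x" for y
    using less[of y] that pos by (simp add: Y_def flip: scal)
  then have "unique_min t (F ` X) (F x)"
    using x by (auto simp: unique_min_def)
  then show ?thesis
    by (auto simp: unique_mins_def)
qed

section \<open>Walks in graphs whose arcs raise a level by one\<close>

context wf_digraph
begin

text \<open>Walks instead of paths, so that cutting and concatenating need no care about
  distinctness; under a level function all walks are paths.\<close>

definition walk_values :: "('b \<Rightarrow> real) \<Rightarrow> ('b \<Rightarrow> real) \<Rightarrow> nat \<Rightarrow> 'a \<Rightarrow> 'a \<Rightarrow> (real \<times> real) set" where
  "walk_values c d n u v = path_objective c d ` {p. awalk u p v \<and> length p = n}"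

lemma path_objective_append:
  fixes c d :: "'b \<Rightarrow> real"
  shows "path_objective c d (p @ q) = path_objective c d p + path_objective c d q"
  by (simp add: path_objective_def)

lemma level_awalk:
  fixes lv :: "'a \<Rightarrow> nat"
  assumes lv: "\<And>e. e \<in> arcs G \<Longrightarrow> lv (head G e) = Suc (lv (tail G e))"
    and "awalk u p v"
  shows "lv v = lv u + length p"
  using assms(2)
  by (induction p arbitrary: u) (auto simp: awalk_Nil_iff awalk_Cons_iff lv)

text \<open>Vertices after \<open>u\<close> lie on strictly higher levels, so \<open>u\<close>
  cannot recur; the second conjunct carries this through the induction.\<close>

lemma level_awalk_distinct:
  fixes lv :: "'a \<Rightarrow> nat"
  assumes lv: "\<And>e. e \<in> arcs G \<Longrightarrow> lv (head G e) = Suc (lv (tail G e))"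
    and "awalk u p v"
  shows "distinct (awalk_verts u p) \<and> (\<forall>x\<in>set (awalk_verts u p). lv u \<le> lv x)"
  using assms(2)
proof (induction p arbitrary: u)
  case (Cons e p)
  then have "tail G e = u" "e \<in> arcs G" "awalk (head G e) p v"
    by (auto simp: awalk_Cons_iff)
  with Cons.IH[of "head G e"] show ?case
    by (fastforce simp: lv)
qed simp

text \<open>A walk is cut after \<open>m\<close> arcs. The level of the cut vertex is forced, so the
  union runs over one level only.\<close>

lemma walk_values_add:
  fixes lv :: "'a \<Rightarrow> nat"
  assumes lv: "\<And>e. e \<in> arcs G \<Longrightarrow> lv (head G e) = Suc (lv (tail G e))"
  shows "walk_values c d (m + n) u v =
    (\<Union>x\<in>{x \<in> verts G. lv x = lv u + m}. walk_values c d m u x + walk_values c d n x v)"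
    (is "?L = ?R")
proof
  show "?L \<subseteq> ?R"
  proof
    fix y assume "y \<in> ?L"
    then obtain p where p: "awalk u p v" "length p = m + n" "y = path_objective c d p"
      by (auto simp: walk_values_def)
    have "awalk u (take m p @ drop m p) v"
      using p by simp
    then obtain x where x: "awalk u (take m p) x" "awalk x (drop m p) v"
      by (auto simp only: awalk_append_iff)
    have "lv x = lv u + m" "x \<in> verts G"
      using level_awalk[OF lv x(1)] p(2) x by auto
    moreover have "y = path_objective c d (take m p) + path_objective c d (drop m p)"
      using p(3) path_objective_append[of c d "take m p" "drop m p"] by simp
    then have "y \<in> walk_values c d m u x + walk_values c d n x v"
      using x p(2) by (auto simp: walk_values_def)
    ultimately show "y \<in> ?R"
      by blast
  qed
next
  show "?R \<subseteq> ?L"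
  proof
    fix y assume "y \<in> ?R"
    then obtain x p q where pq: "awalk u p x" "length p = m" "awalk x q v" "length q = n"
        "y = path_objective c d (p @ q)"
      by (auto simp: walk_values_def path_objective_append elim!: set_plus_elim)
    moreover from pq have "awalk u (p @ q) v"
      by auto
    ultimately show "y \<in> ?L"
      by (auto simp: walk_values_def)
  qed
qed

end

text \<open>The only candidates are the empty walk and a single arc, which is unique because there
  are no parallel arcs.\<close>

lemma (in nomulti_digraph) card_walk_values_le_1:
  assumes "n \<le> 1"
  shows "finite (walk_values c d n u v) \<and> card (walk_values c d n u v) \<le> 1"
proof -
  have "p = q" if "awalk u p v" "length p = n" "awalk u q v" "length q = n" for p q
  proof (cases "n = 0")
    case False
    with assms that obtain e f where "p = [e]" "q = [f]"
      by (metis One_nat_def Suc_leI le_antisym length_0_conv length_Suc_conv neq0_conv)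
    with that show ?thesis
      by (auto simp: awalk_Cons_iff awalk_Nil_iff arc_to_ends_def intro!: no_multi_arcs)
  qed (use that in auto)
  then have "x = y" if "x \<in> walk_values c d n u v" "y \<in> walk_values c d n u v" for x y
    using that by (auto simp: walk_values_def)
  \<comment> \<open>If the set is empty, the arbitrary value of \<open>SOME\<close> does no
    harm.\<close>
  then have "walk_values c d n u v \<subseteq> {SOME x. x \<in> walk_values c d n u v}"
    by (metis singletonI someI subsetI)
  then show ?thesis
    by (metis card_mono finite.emptyI finite_insert finite_subset is_singletonI is_singleton_altdef)
qed

text \<open>Halving the walk sums two sets for each of at most \<open>w\<close> cut vertices, whence
  the factor \<open>2 * w\<close>. Width is bounded on inner levels only, where every cut takes
  place.\<close>

lemma (in nomulti_digraph) card_unique_mins_walk_values: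
  fixes lv :: "'a \<Rightarrow> nat"
  assumes lv: "\<And>e. e \<in> arcs G \<Longrightarrow> lv (head G e) = Suc (lv (tail G e))"
    and width: "\<And>i. 0 < i \<Longrightarrow> i < N \<Longrightarrow>
      finite {x \<in> verts G. lv x = i} \<and> card {x \<in> verts G. lv x = i} \<le> w"
    and bound: "\<And>x. x \<in> verts G \<Longrightarrow> lv x \<le> N"
    and w: "w \<ge> 1"
    and "n \<le> 2 ^ k"
  shows "finite (unique_mins (walk_values c d n u v)) \<and>
    card (unique_mins (walk_values c d n u v)) \<le> (2 * w) ^ k"
  using \<open>n \<le> 2 ^ k\<close>
proof (induction k arbitrary: n u v)
  \<comment> \<open>Stated for every \<open>k\<close>, since very short walks also occur in the
    induction step.\<close>
  have base: "finite (unique_mins (walk_values c d n u v)) \<and>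
    card (unique_mins (walk_values c d n u v)) \<le> (2 * w) ^ k" if "n \<le> 1" for n k u v
  proof -
    have "1 \<le> (2 * w) ^ k"
      using w by simp
    then show ?thesis
      using card_walk_values_le_1[OF that, of c d u v]
        card_mono[OF _ unique_mins_subset, of "walk_values c d n u v"]
        finite_subset[OF unique_mins_subset, of "walk_values c d n u v"]
      by linarith
  qed
  {
    case 0
    then show ?case
      using base[where n = n and k = 0] by simp
  next
    case (Suc k)
    show ?case
    \<comment> \<open>Splitting off emptiness leaves a walk in the other case; its end level gives
      \<open>lv u + n \<le> N\<close>, so the cut level is strictly between 0 and
      \<open>N\<close>.\<close>
    proof (cases "n \<le> 1 \<or> walk_values c d n u v = {}")
      case True
      then show ?thesis
        using base[where n = n and k = "Suc k"] unique_mins_subset[of "{}"] by (auto simp del: power_Suc)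
    next
      case False
      \<comment> \<open>From \<open>n \<le> 2 ^ Suc k\<close> both the floor and the ceiling of
        \<open>n / 2\<close> are at most \<open>2 ^ k\<close>.\<close>
      define m where "m = n div 2"
      have m: "0 < m" "m < n" "m \<le> 2 ^ k" "n - m \<le> 2 ^ k"
        using False Suc.prems by (auto simp: m_def)
      define M where "M = {x \<in> verts G. lv x = lv u + m}"
      define A where "A x = walk_values c d m u x + walk_values c d (n - m) x v" for x
      have W: "walk_values c d n u v = (\<Union>x\<in>M. A x)"
        using walk_values_add[OF lv, of c d m "n - m" u v] m(2) by (simp add: M_def A_def)
      obtain p where p: "awalk u p v" "length p = n"
        using False by (auto simp: walk_values_def)
      then have "lv u + n \<le> N"
        using level_awalk[OF lv p(1)] bound[of v] by auto
      then have M: "finite M" "card M \<le> w"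
        unfolding M_def using width[of "lv u + m"] m by auto
      have A: "finite (unique_mins (A x)) \<and> card (unique_mins (A x)) \<le> 2 * (2 * w) ^ k" for x
        using Suc.IH[OF m(3), of u x] Suc.IH[OF m(4), of x v]
          card_unique_mins_plus[of "walk_values c d m u x" "walk_values c d (n - m) x v"]
        unfolding A_def by linarith
      have fin: "finite (\<Union>x\<in>M. unique_mins (A x))"
        using M A by blast
      have "card (unique_mins (walk_values c d n u v)) \<le> card (\<Union>x\<in>M. unique_mins (A x))"
        unfolding W by (intro card_mono fin unique_mins_UN_subset)
      also have "\<dots> \<le> (\<Sum>x\<in>M. card (unique_mins (A x)))"
        using M(1) by (rule card_UN_le)
      also have "\<dots> \<le> card M * (2 * (2 * w) ^ k)"
        using A sum_bounded_above[of M "\<lambda>x. card (unique_mins (A x))" "2 * (2 * w) ^ k"] by simp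
      also have "\<dots> \<le> w * (2 * (2 * w) ^ k)"
        using M(2) by (rule mult_right_mono) simp
      finally show ?thesis
        using finite_subset[OF unique_mins_UN_subset fin] by (simp add: W algebra_simps)
    qed
  }
qed

section \<open>Layered graphs\<close>

context layered_graph
begin

definition level :: "'a \<Rightarrow> nat" where
  "level x = (if x = s then 0 else if x = t then Suc l else THE i. i \<in> {1..l} \<and> x \<in> L i)"

lemma level_source: "level s = 0"
  by (simp add: level_def)

lemma level_dest: "level t = Suc l"
  using source_neq_dest by (simp add: level_def)

lemma level_layer:
  assumes "i \<in> {1..l}" "x \<in> L i"
  shows "level x = i"
proof -
  have "x \<noteq> s" "x \<noteq> t"
    using assms source_notin_layers dest_notin_layers by auto
  moreover have "(THE i. i \<in> {1..l} \<and> x \<in> L i) = i"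
    using assms layers_disjoint unfolding disjoint_family_on_def by (intro the_equality) blast+
  ultimately show ?thesis
    by (simp add: level_def)
qed

text \<open>\<open>l \<ge> 1\<close> makes \<open>L 1\<close> and \<open>L l\<close> genuine layers,
  whose vertices have levels 1 and \<open>l\<close>.\<close>

lemma level_arc:
  assumes "l \<ge> 1" "e \<in> arcs G"
  shows "level (head G e) = Suc (level (tail G e))"
proof -
  have "(tail G e, head G e) \<in> arcs_ends G"
    using assms(2) by (auto simp: arcs_ends_conv)
  then consider "tail G e = s" "head G e \<in> L 1"
    | i where "i \<in> {1..<l}" "tail G e \<in> L i" "head G e \<in> L (Suc i)"
    | "tail G e \<in> L l" "head G e = t"
    unfolding arcs_eq by blast
  then show ?thesis
  proof cases
    case 1
    then show ?thesis
      using assms(1) level_layer[of 1] by (simp add: level_source)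
  next
    case (2 i)
    then show ?thesis
      using level_layer[of i] level_layer[of "Suc i"] by simp
  next
    case 3
    then show ?thesis
      using assms(1) level_layer[of l] by (simp add: level_dest)
  qed
qed

lemma level_le: "x \<in> verts G \<Longrightarrow> level x \<le> Suc l"
  by (auto simp: verts_eq level_source level_dest level_layer)

lemma level_set_eq:
  assumes "0 < i" "i < Suc l"
  shows "{x \<in> verts G. level x = i} = L i"
  using assms by (auto simp: verts_eq level_source level_dest level_layer)

text \<open>The levels 0 and \<open>Suc l\<close> of the endpoints fix the length, and rising levels
  make every walk a path.\<close>

lemma st_paths_eq:
  assumes "l \<ge> 1"
  shows "st_paths G s t = {p. awalk s p t \<and> length p = Suc l}"
proof -
  have "length p = Suc l" if "awalk s p t" for p
    using level_awalk[OF level_arc[OF assms] that] by (simp add: level_source level_dest)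
  then show ?thesis
    using level_awalk_distinct[OF level_arc[OF assms]] by (auto simp: st_paths_def apath_def)
qed

end

theorem theorem10:
  fixes G :: "('a, 'b) pre_digraph"
    and s t :: 'a
    and l w :: nat
    and L :: "nat \<Rightarrow> 'a set"
    and c d :: "'b \<Rightarrow> real"
    and E :: "'b awalk set"
  assumes "layered_graph G s t l w L"
    and "l \<ge> 1"
    and "w \<ge> 1"
    and "\<And>e. e \<in> arcs G \<Longrightarrow> c e \<ge> 0"
    and "\<And>e. e \<in> arcs G \<Longrightarrow> d e \<ge> 0"
    and "is_E_min (path_objective c d) (st_paths G s t) E"
  shows "finite E \<and> card E \<le> (2 * w) ^ nat \<lceil>log 2 (real l + 1)\<rceil>"
proof -
  interpret layered_graph G s t l w L
    by (rule assms(1))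
  let ?F = "path_objective c d" and ?X = "st_paths G s t"
  let ?U = "unique_mins (walk_values c d (Suc l) s t)"
  define k where "k = nat \<lceil>log 2 (real l + 1)\<rceil>"
  have "log 2 (real l + 1) \<le> real k"
    unfolding k_def by linarith
  \<comment> \<open>The exponent is just large enough for the \<open>Suc l\<close> arcs of an
    \<open>s\<close>-\<open>t\<close> path to fit into \<open>2 ^ k\<close>.\<close>
  then have "real (Suc l) \<le> 2 powr real k"
    by (simp add: log_le_iff)
  then have "Suc l \<le> 2 ^ k"
    by (metis of_nat_le_iff of_nat_numeral of_nat_power powr_realpow
        zero_less_numeral)
  then have U: "finite ?U \<and> card ?U \<le> (2 * w) ^ k"
    using level_le assms(2,3) layer_finite layer_card
    by (intro card_unique_mins_walk_values[where lv = level and N = "Suc l"])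
      (auto simp: level_arc level_set_eq)
  have "finite (?F ` ?X)"
    using apaths_finite by (simp add: st_paths_def)
  moreover have "E \<subseteq> {x \<in> ?X. ?F x extreme_point_of upper_image ?F ?X}"
    using assms(6) by (simp add: is_E_min_def efficient_extreme_def)
  ultimately have "?F ` E \<subseteq> unique_mins (?F ` ?X)"
    by (auto intro!: extreme_point_in_unique_mins)
  then have sub: "?F ` E \<subseteq> ?U"
    by (simp add: st_paths_eq[OF assms(2)] walk_values_def)
  \<comment> \<open>Inequivalence lets solutions be counted by their values, which lie in
    \<open>?U\<close>.\<close>
  have "inj_on ?F E"
    using assms(6) by (auto simp: is_E_min_def pairwise_inequivalent_def inj_on_def)
  then show ?thesis
    using U sub card_inj_on_le[of ?F E ?U] inj_on_finite[of ?F E ?U] by (auto simp flip: k_def)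
qed

end
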